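(* Let $(\mathfrak g,B)$ be a Rota-Baxter Lie algebra of weight $-1$, let $\widetilde B=\mathrm{id}-B$, and let $(\mathfrak g_+,\mathfrak g_-,\rhd,\blacktriangleright)$ be the matched pair of Lie algebras on $(\mathfrak g,B)$. Let $\widetilde C:\mathfrak g_+\bowtie\mathfrak g_-\to\mathfrak g_+\bowtie\mathfrak g_-$ be given by $$\widetilde C\big((B(x_1),\widetilde B(x_2))\big)=\big(B\circ\widetilde B(x_1-x_2),\ -\widetilde B\circ B(x_1-x_2)\big),\qquad\forall x_1,x_2\in\mathfrak g,$$ and let $\mathfrak g_2=\mathrm{Im}\,\widetilde C$. Define $B_2,\widetilde{B_2}:\mathfrak g_2\to\mathfrak g_2$ by $B_2((x,u))=\widetilde C((0,u))$ and $\widetilde{B_2}((x,u))=\widetilde C((x,0))$ for all $(x,u)\in\mathfrak g_2$. Let $\mathfrak h_+=\ker\widetilde B$, $\mathfrak h_-=\ker B$, and let $\overline B$ and $\widetilde{\overline B}$ be the operators on $\mathfrak g_B/(\mathfrak h_++\mathfrak h_-)$ and $\mathfrak g_{\widetilde B}/(\mathfrak h_++\mathfrak h_-)$ defined by $\overline B(\overline x)=\overline{B(x)}$ and $\widetilde{\overline B}(\overline x)=\overline{\widetilde B(x)}$ respectively, for $x\in\mathfrak g$. Then: (a) $(\mathfrak g_2,B_2)$ is a Rota-Baxter Lie algebra of weight $-1$ that is Rota-Baxter isomorphic to $(\mathfrak g_B/(\mathfrak h_++\mathfrak h_-),\overline B)$; (b) $(\mathfrak g_2,\widetilde{B_2})$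 is a Rota-Baxter Lie algebra of weight $-1$ that is Rota-Baxter isomorphic to $(\mathfrak g_{\widetilde B}/(\mathfrak h_++\mathfrak h_-),\widetilde{\overline B})$.
   Context: Lie algebras are over a field $\mathbb K$. A Rota-Baxter operator of weight $\lambda$ on a Lie algebra $\mathfrak g$ is a linear map $B:\mathfrak g\to\mathfrak g$ with $[B(x),B(y)]=B([B(x),y]+[x,B(y)]+\lambda[x,y])$ for all $x,y$; $(\mathfrak g,B)$ is then a Rota-Baxter Lie algebra of weight $\lambda$. A Rota-Baxter Lie algebra homomorphism $f:(\mathfrak g,B)\to(\mathfrak g',B')$ is a Lie algebra homomorphism with $f\circ B=B'\circ f$; Rota-Baxter isomorphic means there is a bijective such $f$. For $(\mathfrak g,B)$ of weight $-1$ put $\widetilde B=\mathrm{id}-B$ (also a Rota-Baxter operator of weight $-1$), $\mathfrak g_+=\mathrm{Im}\,B$, $\mathfrak g_-=\mathrm{Im}\,\widetilde B$. The matched pair of Lie algebras on $(\mathfrak g,B)$ is $(\mathfrak g_+,\mathfrak g_-,\rhd,\blacktriangleright)$ with the well-defined maps $B(x)\rhd\widetilde B(y)=\widetilde B([B(x),y])$ and $\widetilde B(x)\blacktriangleright B(y)=B([\widetilde B(x),y])$. Its bicrossed product $\mathfrak g_+\bowtie\mathfrak g_-$ is the (external) vector space direct sum $\mathfrak g_+\oplus\mathfrak g_-$ with the Lie bracket $$[(x,u),(y,v)]_{\bowtie}=\big([x,y]+u\blacktriangleright y-v\blacktriangleright x,\ [u,v]+x\rhd v-y\rhd u\big).$$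 The map $\widetilde C$ is an idempotent Lie algebra homomorphism, so $\mathfrak g_2$ is a Lie subalgebra of $\mathfrak g_+\bowtie\mathfrak g_-$. The descendent Lie algebra $\mathfrak g_B$ is the vector space $\mathfrak g$ with bracket $[x,y]_B=[B(x),y]+[x,B(y)]-[x,y]$, and $\mathfrak g_{\widetilde B}$ is defined likewise from $\widetilde B$. The subspace $\mathfrak h_++\mathfrak h_-$ (vector space sum) is an ideal of both $\mathfrak g_B$ and $\mathfrak g_{\widetilde B}$, and $\overline x$ denotes the class of $x$ in the quotient; $\overline B$ and $\widetilde{\overline B}$ are well defined Rota-Baxter operators of weight $-1$. *)

theory Defs
  imports "HOL-Algebra.Module" "HOL-Algebra.AbelCoset"
begin

text \<open>
  Lie algebras are modeled by explicit carriers on top of the \<^const>\<open>module\<close> records of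
  HOL-Algebra. These records inherit the fields \<^const>\<open>mult\<close> and \<^const>\<open>one\<close> from rings, which the
  module axioms do not constrain; below they are set to \<^const>\<open>undefined\<close> when a new record is built.
\<close>

record ('k, 'a) lie = "('k, 'a) module" +
  bracket :: "'a \<Rightarrow> 'a \<Rightarrow> 'a" (\<open>\<lbrakk>_, _\<rbrakk>\<index>\<close>)

locale lie_algebra = K?: field K + L?: module K L for K (structure) and L (structure) +
  assumes bracket_closed [simp, intro]:
      "x \<in> carrier L \<Longrightarrow> y \<in> carrier L \<Longrightarrow> \<lbrakk>x, y\<rbrakk>\<^bsub>L\<^esub> \<in> carrier L"
    and bracket_add_left:
      "x \<in> carrier L \<Longrightarrow> y \<in> carrier L \<Longrightarrow> z \<in> carrier L \<Longrightarrow>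
        \<lbrakk>x \<oplus>\<^bsub>L\<^esub> y, z\<rbrakk>\<^bsub>L\<^esub> = \<lbrakk>x, z\<rbrakk>\<^bsub>L\<^esub> \<oplus>\<^bsub>L\<^esub> \<lbrakk>y, z\<rbrakk>\<^bsub>L\<^esub>"
    and bracket_add_right:
      "x \<in> carrier L \<Longrightarrow> y \<in> carrier L \<Longrightarrow> z \<in> carrier L \<Longrightarrow>
        \<lbrakk>x, y \<oplus>\<^bsub>L\<^esub> z\<rbrakk>\<^bsub>L\<^esub> = \<lbrakk>x, y\<rbrakk>\<^bsub>L\<^esub> \<oplus>\<^bsub>L\<^esub> \<lbrakk>x, z\<rbrakk>\<^bsub>L\<^esub>"
    and bracket_smult_left:
      "a \<in> carrier K \<Longrightarrow> x \<in> carrier L \<Longrightarrow> y \<in> carrier L \<Longrightarrow>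
        \<lbrakk>a \<odot>\<^bsub>L\<^esub> x, y\<rbrakk>\<^bsub>L\<^esub> = a \<odot>\<^bsub>L\<^esub> \<lbrakk>x, y\<rbrakk>\<^bsub>L\<^esub>"
    and bracket_smult_right:
      "a \<in> carrier K \<Longrightarrow> x \<in> carrier L \<Longrightarrow> y \<in> carrier L \<Longrightarrow>
        \<lbrakk>x, a \<odot>\<^bsub>L\<^esub> y\<rbrakk>\<^bsub>L\<^esub> = a \<odot>\<^bsub>L\<^esub> \<lbrakk>x, y\<rbrakk>\<^bsub>L\<^esub>"
    and bracket_alternating:
      "x \<in> carrier L \<Longrightarrow> \<lbrakk>x, x\<rbrakk>\<^bsub>L\<^esub> = \<zero>\<^bsub>L\<^esub>"
    and jacobi:
      "x \<in> carrier L \<Longrightarrow> y \<in> carrier L \<Longrightarrow> z \<in> carrier L \<Longrightarrow>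
        \<lbrakk>x, \<lbrakk>y, z\<rbrakk>\<^bsub>L\<^esub>\<rbrakk>\<^bsub>L\<^esub> \<oplus>\<^bsub>L\<^esub> \<lbrakk>y, \<lbrakk>z, x\<rbrakk>\<^bsub>L\<^esub>\<rbrakk>\<^bsub>L\<^esub> \<oplus>\<^bsub>L\<^esub> \<lbrakk>z, \<lbrakk>x, y\<rbrakk>\<^bsub>L\<^esub>\<rbrakk>\<^bsub>L\<^esub> = \<zero>\<^bsub>L\<^esub>"

definition linear_hom ::
  "('k, 'r) ring_scheme \<Rightarrow> ('k, 'a, 'm) module_scheme \<Rightarrow> ('k, 'b, 'n) module_scheme \<Rightarrow> ('a \<Rightarrow> 'b) set"
  where "linear_hom K M N = {f. f \<in> carrier M \<rightarrow> carrier N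
    \<and> (\<forall>x\<in>carrier M. \<forall>y\<in>carrier M. f (x \<oplus>\<^bsub>M\<^esub> y) = f x \<oplus>\<^bsub>N\<^esub> f y)
    \<and> (\<forall>a\<in>carrier K. \<forall>x\<in>carrier M. f (a \<odot>\<^bsub>M\<^esub> x) = a \<odot>\<^bsub>N\<^esub> f x)}"

definition lie_hom ::
  "('k, 'r) ring_scheme \<Rightarrow> ('k, 'a, 'm) lie_scheme \<Rightarrow> ('k, 'b, 'n) lie_scheme \<Rightarrow> ('a \<Rightarrow> 'b) set"
  where "lie_hom K L L' = {f \<in> linear_hom K L L'.
    \<forall>x\<in>carrier L. \<forall>y\<in>carrier L. f \<lbrakk>x, y\<rbrakk>\<^bsub>L\<^esub> = \<lbrakk>f x, f y\<rbrakk>\<^bsub>L'\<^esub>}"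

locale rota_baxter_lie_algebra = lie_algebra K L for K (structure) and L (structure) +
  fixes \<mu> and B
  assumes weight_closed: "\<mu> \<in> carrier K"
    and operator_linear: "B \<in> linear_hom K L L"
    and rota_baxter:
      "x \<in> carrier L \<Longrightarrow> y \<in> carrier L \<Longrightarrow>
        \<lbrakk>B x, B y\<rbrakk>\<^bsub>L\<^esub> = B (\<lbrakk>B x, y\<rbrakk>\<^bsub>L\<^esub> \<oplus>\<^bsub>L\<^esub> \<lbrakk>x, B y\<rbrakk>\<^bsub>L\<^esub> \<oplus>\<^bsub>L\<^esub> \<mu> \<odot>\<^bsub>L\<^esub> \<lbrakk>x, y\<rbrakk>\<^bsub>L\<^esub>)"

locale rota_baxter_lie_hom =
  dom: rota_baxter_lie_algebra K L \<mu> B + cod: rota_baxter_lie_algebra K L' \<mu> B'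
  for K and \<mu> and L and B and L' and B' +
  fixes f
  assumes hom: "f \<in> lie_hom K L L'"
    and commute: "x \<in> carrier L \<Longrightarrow> f (B x) = B' (f x)"

definition rota_baxter_isomorphic ::
  "('k, 'r) ring_scheme \<Rightarrow> 'k \<Rightarrow> ('k, 'a, 'm) lie_scheme \<Rightarrow> ('a \<Rightarrow> 'a)
    \<Rightarrow> ('k, 'b, 'n) lie_scheme \<Rightarrow> ('b \<Rightarrow> 'b) \<Rightarrow> bool"
  where "rota_baxter_isomorphic K \<mu> L B L' B' \<longleftrightarrow>
    (\<exists>f. rota_baxter_lie_hom K \<mu> L B L' B' f \<and> bij_betw f (carrier L) (carrier L'))"


subsection \<open>Subalgebras, quotients and descendent Lie algebras\<close>

definition restrict_lie :: "('k, 'a, 'm) lie_scheme \<Rightarrow> 'a set \<Rightarrow> ('k, 'a, 'm) lie_scheme"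
  where "restrict_lie L S = L\<lparr>carrier := S\<rparr>"

text \<open>As for quotient rings in HOL-Algebra, an operation on cosets is the union of the cosets of all
  the results on representatives; for an ideal \<open>H\<close> these cosets coincide.\<close>

definition quotient_lie :: "('k, 'a, 'm) lie_scheme \<Rightarrow> 'a set \<Rightarrow> ('k, 'a set) lie"
  where "quotient_lie L H =
    \<lparr>carrier = a_rcosets\<^bsub>L\<^esub> H, mult = undefined, one = undefined,
     zero = H, add = set_add L,
     smult = (\<lambda>a X. \<Union>x\<in>X. H +>\<^bsub>L\<^esub> (a \<odot>\<^bsub>L\<^esub> x)),
     bracket = (\<lambda>X Y. \<Union>x\<in>X. \<Union>y\<in>Y. H +>\<^bsub>L\<^esub> \<lbrakk>x, y\<rbrakk>\<^bsub>L\<^esub>)\<rparr>"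

definition quotient_map :: "('k, 'a, 'm) lie_scheme \<Rightarrow> 'a set \<Rightarrow> ('a \<Rightarrow> 'a) \<Rightarrow> 'a set \<Rightarrow> 'a set"
  where "quotient_map L H B X = (\<Union>x\<in>X. H +>\<^bsub>L\<^esub> B x)"

text \<open>The descendent Lie algebra of an operator of weight \<open>-1\<close>.\<close>

definition descendent :: "('k, 'a, 'm) lie_scheme \<Rightarrow> ('a \<Rightarrow> 'a) \<Rightarrow> ('k, 'a, 'm) lie_scheme"
  where "descendent L B =
    L\<lparr>bracket := (\<lambda>x y. \<lbrakk>B x, y\<rbrakk>\<^bsub>L\<^esub> \<oplus>\<^bsub>L\<^esub> \<lbrakk>x, B y\<rbrakk>\<^bsub>L\<^esub> \<ominus>\<^bsub>L\<^esub> \<lbrakk>x, y\<rbrakk>\<^bsub>L\<^esub>)\<rparr>"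


subsection \<open>The matched pair of a Rota-Baxter Lie algebra of weight \<open>-1\<close>\<close>

definition tilde :: "('k, 'a, 'm) lie_scheme \<Rightarrow> ('a \<Rightarrow> 'a) \<Rightarrow> 'a \<Rightarrow> 'a"
  where "tilde L B x = x \<ominus>\<^bsub>L\<^esub> B x"

definition g_plus :: "('k, 'a, 'm) lie_scheme \<Rightarrow> ('a \<Rightarrow> 'a) \<Rightarrow> ('k, 'a, 'm) lie_scheme"
  where "g_plus L B = restrict_lie L (B ` carrier L)"

definition g_minus :: "('k, 'a, 'm) lie_scheme \<Rightarrow> ('a \<Rightarrow> 'a) \<Rightarrow> ('k, 'a, 'm) lie_scheme"
  where "g_minus L B = restrict_lie L (tilde L B ` carrier L)"

text \<open>The actions and the map \<open>C\<close> below are given by formulas in terms of preimages; that the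
  described values are unique is shown in \<open>rhd_act_eq\<close>, \<open>brhd_act_eq\<close> and \<open>C_tilde_eq\<close>.\<close>

definition rhd_act :: "('k, 'a, 'm) lie_scheme \<Rightarrow> ('a \<Rightarrow> 'a) \<Rightarrow> 'a \<Rightarrow> 'a \<Rightarrow> 'a"
  where "rhd_act L B a u = (THE w. \<exists>x\<in>carrier L. \<exists>y\<in>carrier L.
    a = B x \<and> u = tilde L B y \<and> w = tilde L B \<lbrakk>B x, y\<rbrakk>\<^bsub>L\<^esub>)"

definition brhd_act :: "('k, 'a, 'm) lie_scheme \<Rightarrow> ('a \<Rightarrow> 'a) \<Rightarrow> 'a \<Rightarrow> 'a \<Rightarrow> 'a"
  where "brhd_act L B u a = (THE w. \<exists>x\<in>carrier L. \<exists>y\<in>carrier L.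
    u = tilde L B x \<and> a = B y \<and> w = B \<lbrakk>tilde L B x, y\<rbrakk>\<^bsub>L\<^esub>)"

text \<open>The bicrossed product of two Lie algebras \<open>P\<close> and \<open>N\<close> with actions \<open>r\<close> of \<open>P\<close> on \<open>N\<close>
  (written \<open>\<rhd>\<close> on paper) and \<open>l\<close> of \<open>N\<close> on \<open>P\<close> (written as a filled triangle).\<close>

definition bicrossed_product ::
  "('k, 'a, 'm) lie_scheme \<Rightarrow> ('k, 'b, 'n) lie_scheme \<Rightarrow> ('a \<Rightarrow> 'b \<Rightarrow> 'b) \<Rightarrow> ('b \<Rightarrow> 'a \<Rightarrow> 'a)
    \<Rightarrow> ('k, 'a \<times> 'b) lie"
  where "bicrossed_product P N r l =
    \<lparr>carrier = carrier P \<times> carrier N, mult = undefined, one = undefined,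
     zero = (\<zero>\<^bsub>P\<^esub>, \<zero>\<^bsub>N\<^esub>),
     add = (\<lambda>(x, u) (y, v). (x \<oplus>\<^bsub>P\<^esub> y, u \<oplus>\<^bsub>N\<^esub> v)),
     smult = (\<lambda>a (x, u). (a \<odot>\<^bsub>P\<^esub> x, a \<odot>\<^bsub>N\<^esub> u)),
     bracket = (\<lambda>(x, u) (y, v).
       (\<lbrakk>x, y\<rbrakk>\<^bsub>P\<^esub> \<oplus>\<^bsub>P\<^esub> l u y \<ominus>\<^bsub>P\<^esub> l v x, \<lbrakk>u, v\<rbrakk>\<^bsub>N\<^esub> \<oplus>\<^bsub>N\<^esub> r x v \<ominus>\<^bsub>N\<^esub> r y u))\<rparr>"

definition bicrossed :: "('k, 'a, 'm) lie_scheme \<Rightarrow> ('a \<Rightarrow> 'a) \<Rightarrow> ('k, 'a \<times> 'a) lie"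
  where "bicrossed L B = bicrossed_product (g_plus L B) (g_minus L B) (rhd_act L B) (brhd_act L B)"

definition C_tilde :: "('k, 'a, 'm) lie_scheme \<Rightarrow> ('a \<Rightarrow> 'a) \<Rightarrow> 'a \<times> 'a \<Rightarrow> 'a \<times> 'a"
  where "C_tilde L B p = (THE q. \<exists>x1\<in>carrier L. \<exists>x2\<in>carrier L.
    p = (B x1, tilde L B x2) \<and>
    q = (B (tilde L B (x1 \<ominus>\<^bsub>L\<^esub> x2)), \<ominus>\<^bsub>L\<^esub> tilde L B (B (x1 \<ominus>\<^bsub>L\<^esub> x2))))"

definition g_two :: "('k, 'a, 'm) lie_scheme \<Rightarrow> ('a \<Rightarrow> 'a) \<Rightarrow> ('k, 'a \<times> 'a) lie"
  where "g_two L B = restrict_lie (bicrossed L B) (C_tilde L B ` carrier (bicrossed L B))"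

definition B_two :: "('k, 'a, 'm) lie_scheme \<Rightarrow> ('a \<Rightarrow> 'a) \<Rightarrow> 'a \<times> 'a \<Rightarrow> 'a \<times> 'a"
  where "B_two L B = (\<lambda>(x, u). C_tilde L B (\<zero>\<^bsub>L\<^esub>, u))"

definition B_two_tilde :: "('k, 'a, 'm) lie_scheme \<Rightarrow> ('a \<Rightarrow> 'a) \<Rightarrow> 'a \<times> 'a \<Rightarrow> 'a \<times> 'a"
  where "B_two_tilde L B = (\<lambda>(x, u). C_tilde L B (x, \<zero>\<^bsub>L\<^esub>))"

definition h_plus :: "('k, 'a, 'm) lie_scheme \<Rightarrow> ('a \<Rightarrow> 'a) \<Rightarrow> 'a set"
  where "h_plus L B = a_kernel L L (tilde L B)"

definition h_minus :: "('k, 'a, 'm) lie_scheme \<Rightarrow> ('a \<Rightarrow> 'a) \<Rightarrow> 'a set"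
  where "h_minus L B = a_kernel L L B"

subsection \<open>Well-definedness\<close>

locale rota_baxter_minus_one = rota_baxter_lie_algebra K L "\<ominus>\<^bsub>K\<^esub> \<one>\<^bsub>K\<^esub>" B
  for K (structure) and L (structure) and B
begin

lemma B_closed [simp]: "x \<in> carrier L \<Longrightarrow> B x \<in> carrier L"
  using operator_linear by (auto simp: linear_hom_def)

lemma B_add: "x \<in> carrier L \<Longrightarrow> y \<in> carrier L \<Longrightarrow> B (x \<oplus>\<^bsub>L\<^esub> y) = B x \<oplus>\<^bsub>L\<^esub> B y"
  using operator_linear by (auto simp: linear_hom_def)

lemma additive_minus:
  assumes f: "f \<in> carrier L \<rightarrow> carrier L"
    and add: "\<And>x y. x \<in> carrier L \<Longrightarrow> y \<in> carrier L \<Longrightarrow> f (x \<oplus>\<^bsub>L\<^esub> y) = f x \<oplus>\<^bsub>L\<^esub> f y"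
    and x: "x \<in> carrier L" and y: "y \<in> carrier L"
  shows "f (x \<ominus>\<^bsub>L\<^esub> y) = f x \<ominus>\<^bsub>L\<^esub> f y"
proof -
  have c: "f x \<in> carrier L" "f y \<in> carrier L" "f (x \<ominus>\<^bsub>L\<^esub> y) \<in> carrier L"
    using f x y by (auto simp: M.minus_closed)
  have "f x = f ((x \<ominus>\<^bsub>L\<^esub> y) \<oplus>\<^bsub>L\<^esub> y)"
    using x y by (simp add: M.minus_eq M.a_assoc M.l_neg)
  also have "\<dots> = f (x \<ominus>\<^bsub>L\<^esub> y) \<oplus>\<^bsub>L\<^esub> f y"
    using x y by (simp add: add M.minus_closed)
  finally show ?thesis
    using c by (simp add: M.minus_eq M.a_assoc M.r_neg)
qed

lemma B_minus: "x \<in> carrier L \<Longrightarrow> y \<in> carrier L \<Longrightarrow> B (x \<ominus>\<^bsub>L\<^esub> y) = B x \<ominus>\<^bsub>L\<^esub> B y"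
  by (rule additive_minus) (auto simp: B_add)

lemma tilde_closed [simp]: "x \<in> carrier L \<Longrightarrow> tilde L B x \<in> carrier L"
  by (simp add: tilde_def M.minus_closed)

lemma tilde_add:
  "x \<in> carrier L \<Longrightarrow> y \<in> carrier L \<Longrightarrow>
    tilde L B (x \<oplus>\<^bsub>L\<^esub> y) = tilde L B x \<oplus>\<^bsub>L\<^esub> tilde L B y"
  by (simp add: tilde_def B_add M.minus_eq M.minus_add M.a_ac)

lemma tilde_minus:
  "x \<in> carrier L \<Longrightarrow> y \<in> carrier L \<Longrightarrow>
    tilde L B (x \<ominus>\<^bsub>L\<^esub> y) = tilde L B x \<ominus>\<^bsub>L\<^esub> tilde L B y"
  by (rule additive_minus) (auto simp: tilde_add)

lemma bracket_minus_right:
  "x \<in> carrier L \<Longrightarrow> y \<in> carrier L \<Longrightarrow> z \<in> carrier L \<Longrightarrow>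
    \<lbrakk>x, y \<ominus>\<^bsub>L\<^esub> z\<rbrakk>\<^bsub>L\<^esub> = \<lbrakk>x, y\<rbrakk>\<^bsub>L\<^esub> \<ominus>\<^bsub>L\<^esub> \<lbrakk>x, z\<rbrakk>\<^bsub>L\<^esub>"
  by (rule additive_minus) (auto simp: bracket_add_right)

lemma bracket_minus_left:
  "x \<in> carrier L \<Longrightarrow> y \<in> carrier L \<Longrightarrow> z \<in> carrier L \<Longrightarrow>
    \<lbrakk>x \<ominus>\<^bsub>L\<^esub> y, z\<rbrakk>\<^bsub>L\<^esub> = \<lbrakk>x, z\<rbrakk>\<^bsub>L\<^esub> \<ominus>\<^bsub>L\<^esub> \<lbrakk>y, z\<rbrakk>\<^bsub>L\<^esub>"
  by (rule additive_minus[where f = "\<lambda>u. \<lbrakk>u, z\<rbrakk>\<^bsub>L\<^esub>"]) (auto simp: bracket_add_left)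

lemma minus_eq_zero_iff:
  "x \<in> carrier L \<Longrightarrow> y \<in> carrier L \<Longrightarrow> x \<ominus>\<^bsub>L\<^esub> y = \<zero>\<^bsub>L\<^esub> \<longleftrightarrow> x = y"
  by (metis M.minus_eq M.a_inv_closed M.minus_equality M.minus_minus M.r_neg)

lemma rota_baxter':
  assumes "x \<in> carrier L" "y \<in> carrier L"
  shows "\<lbrakk>B x, B y\<rbrakk>\<^bsub>L\<^esub> = B (\<lbrakk>B x, y\<rbrakk>\<^bsub>L\<^esub> \<oplus>\<^bsub>L\<^esub> \<lbrakk>x, B y\<rbrakk>\<^bsub>L\<^esub> \<ominus>\<^bsub>L\<^esub> \<lbrakk>x, y\<rbrakk>\<^bsub>L\<^esub>)"
  using rota_baxter[OF assms] assms
  by (simp add: M.minus_eq smult_l_minus)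

lemma tilde_bracket_zero:
  assumes x: "x \<in> carrier L" and z: "z \<in> carrier L" and "tilde L B z = \<zero>\<^bsub>L\<^esub>"
  shows "tilde L B \<lbrakk>B x, z\<rbrakk>\<^bsub>L\<^esub> = \<zero>\<^bsub>L\<^esub>"
proof -
  have Bz: "B z = z"
    using assms minus_eq_zero_iff[of z "B z"] by (simp add: tilde_def)
  have "\<lbrakk>B x, z\<rbrakk>\<^bsub>L\<^esub> = B \<lbrakk>B x, z\<rbrakk>\<^bsub>L\<^esub>"
    using rota_baxter'[OF x z] x z unfolding Bz
    by (simp add: M.minus_eq M.a_assoc M.r_neg)
  then show ?thesis
    using x z by (simp add: tilde_def minus_eq_zero_iff)
qed

lemma zero_right: "x \<in> carrier L \<Longrightarrow> \<lbrakk>x, \<zero>\<^bsub>L\<^esub>\<rbrakk>\<^bsub>L\<^esub> = \<zero>\<^bsub>L\<^esub>"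
  using bracket_minus_right[of x x x] by (simp add: M.minus_eq M.r_neg)

lemma bracket_zero:
  assumes x: "x \<in> carrier L" and z: "z \<in> carrier L" and Bz: "B z = \<zero>\<^bsub>L\<^esub>"
  shows "B \<lbrakk>tilde L B x, z\<rbrakk>\<^bsub>L\<^esub> = \<zero>\<^bsub>L\<^esub>"
proof -
  have "B (\<lbrakk>B x, z\<rbrakk>\<^bsub>L\<^esub> \<ominus>\<^bsub>L\<^esub> \<lbrakk>x, z\<rbrakk>\<^bsub>L\<^esub>) = \<zero>\<^bsub>L\<^esub>"
    using rota_baxter'[OF x z] x z by (simp add: Bz zero_right)
  then have "B \<lbrakk>B x, z\<rbrakk>\<^bsub>L\<^esub> = B \<lbrakk>x, z\<rbrakk>\<^bsub>L\<^esub>"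
    using x z by (simp add: B_minus minus_eq_zero_iff)
  then show ?thesis
    using x z by (simp add: tilde_def bracket_minus_left B_minus minus_eq_zero_iff)
qed

lemma rhd_act_eq:
  assumes "x \<in> carrier L" "y \<in> carrier L"
  shows "rhd_act L B (B x) (tilde L B y) = tilde L B \<lbrakk>B x, y\<rbrakk>\<^bsub>L\<^esub>"
proof -
  have "tilde L B \<lbrakk>B x', y'\<rbrakk>\<^bsub>L\<^esub> = tilde L B \<lbrakk>B x, y\<rbrakk>\<^bsub>L\<^esub>"
    if "x' \<in> carrier L" "y' \<in> carrier L" "B x = B x'" "tilde L B y = tilde L B y'" for x' y'
    using tilde_bracket_zero[of x "y' \<ominus>\<^bsub>L\<^esub> y"] that assms
    by (simp add: M.minus_closed tilde_minus bracket_minus_right minus_eq_zero_iff)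
  then show ?thesis
    unfolding rhd_act_def using assms by (intro the_equality) blast+
qed

lemma brhd_act_eq:
  assumes "x \<in> carrier L" "y \<in> carrier L"
  shows "brhd_act L B (tilde L B x) (B y) = B \<lbrakk>tilde L B x, y\<rbrakk>\<^bsub>L\<^esub>"
proof -
  have "B \<lbrakk>tilde L B x', y'\<rbrakk>\<^bsub>L\<^esub> = B \<lbrakk>tilde L B x, y\<rbrakk>\<^bsub>L\<^esub>"
    if "x' \<in> carrier L" "y' \<in> carrier L" "tilde L B x = tilde L B x'" "B y = B y'" for x' y'
    using bracket_zero[of x "y' \<ominus>\<^bsub>L\<^esub> y"] that assms
    by (simp add: M.minus_closed B_minus bracket_minus_right minus_eq_zero_iff)
  then show ?thesis
    unfolding brhd_act_def using assms by (intro the_equality) blast+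
qed

lemma B_tilde: "x \<in> carrier L \<Longrightarrow> B (tilde L B x) = tilde L B (B x)"
  by (simp add: tilde_def B_minus)

lemma C_tilde_eq:
  assumes "x1 \<in> carrier L" "x2 \<in> carrier L"
  shows "C_tilde L B (B x1, tilde L B x2) =
    (B (tilde L B (x1 \<ominus>\<^bsub>L\<^esub> x2)), \<ominus>\<^bsub>L\<^esub> tilde L B (B (x1 \<ominus>\<^bsub>L\<^esub> x2)))"
proof -
  have eq: "tilde L B (B (y1 \<ominus>\<^bsub>L\<^esub> y2)) = tilde L B (B (x1 \<ominus>\<^bsub>L\<^esub> x2))"
    if "y1 \<in> carrier L" "y2 \<in> carrier L" "B x1 = B y1" "tilde L B x2 = tilde L B y2" for y1 y2
  proof -
    have "tilde L B (B z1) \<ominus>\<^bsub>L\<^esub> B (tilde L B z2) = tilde L B (B (z1 \<ominus>\<^bsub>L\<^esub> z2))"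
      if "z1 \<in> carrier L" "z2 \<in> carrier L" for z1 z2
      using that by (simp add: B_minus tilde_minus B_tilde)
    then show ?thesis
      using that assms by metis
  qed
  have eq': "(B (tilde L B (y1 \<ominus>\<^bsub>L\<^esub> y2)), \<ominus>\<^bsub>L\<^esub> tilde L B (B (y1 \<ominus>\<^bsub>L\<^esub> y2))) =
      (B (tilde L B (x1 \<ominus>\<^bsub>L\<^esub> x2)), \<ominus>\<^bsub>L\<^esub> tilde L B (B (x1 \<ominus>\<^bsub>L\<^esub> x2)))"
    if "y1 \<in> carrier L" "y2 \<in> carrier L"
      "(B x1, tilde L B x2) = (B y1, tilde L B y2)" for y1 y2
    using eq[of y1 y2] that assms by (simp only: prod.inject B_tilde M.minus_closed simp_thms)
  show ?thesis
    unfolding C_tilde_def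
  proof (rule the_equality)
    show "\<exists>y1\<in>carrier L. \<exists>y2\<in>carrier L. (B x1, tilde L B x2) = (B y1, tilde L B y2) \<and>
      (B (tilde L B (x1 \<ominus>\<^bsub>L\<^esub> x2)), \<ominus>\<^bsub>L\<^esub> tilde L B (B (x1 \<ominus>\<^bsub>L\<^esub> x2))) =
      (B (tilde L B (y1 \<ominus>\<^bsub>L\<^esub> y2)), \<ominus>\<^bsub>L\<^esub> tilde L B (B (y1 \<ominus>\<^bsub>L\<^esub> y2)))"
      using assms by blast
  qed (elim bexE conjE, simp only: eq')
qed

end

end

theory Submission
  imports Defs
begin

text \<open>
  Write \<open>T = id - B\<close> and \<open>D = B \<circ> T = T \<circ> B\<close>. The image of \<open>C_tilde\<close> is the antidiagonal
  \<open>{(D x, - D x) | x \<in> L}\<close>, so \<open>g_two\<close> is the image of the linear map \<open>antidiag x = (D x, - D x)\<close>.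
  Three facts about this map give both parts of the theorem.

  Its kernel is \<open>h_plus + h_minus\<close>, because \<open>x = B x + T x\<close> (\<open>h_plus_add_h_minus\<close>).

  It intertwines \<open>B\<close> with \<open>B_two\<close> and \<open>T\<close> with \<open>B_two_tilde\<close>, because
  \<open>C_tilde (0, - D x) = antidiag (B x)\<close> and \<open>C_tilde (D x, 0) = antidiag (T x)\<close>
  (\<open>B_two_antidiag\<close>, \<open>B_two_tilde_antidiag\<close>).

  It takes the descendent bracket \<open>[x, y]_B\<close> to the bicrossed bracket of the images
  (\<open>antidiag_bracket\<close>): expanding \<open>[D x, D y]\<close> by the Rota-Baxter identity produces two terms that
  cancel against the actions, and what remains is \<open>D [x, y]_B\<close>.

  So \<open>antidiag\<close> is a surjective homomorphism from \<open>g_B\<close> with operator \<open>B\<close>, and the first isomorphism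
  theorem (\<open>first_isomorphism\<close>) yields (a). Since \<open>[x, y]_T = - [x, y]_B\<close>
  (\<open>tilde_descendent_bracket\<close>), the map \<open>- antidiag\<close> is likewise a surjective homomorphism from
  the descendent Lie algebra of \<open>T\<close> with operator \<open>T\<close>, with the same kernel, which yields (b).

  The Lie and Rota-Baxter axioms have to be checked directly only for the descendent Lie algebras
  (\<open>descendent_rota_baxter\<close>); \<open>g_two\<close> and the quotients inherit them as homomorphic images
  (\<open>image_rota_baxter_lie_algebra\<close>).
\<close>

section \<open>Surjective homomorphisms of Rota-Baxter Lie algebras\<close>

text \<open>
  The target \<open>N\<close> is a bare record here: that it is a Rota-Baxter Lie algebra is a consequence. Its
  zero has to be matched explicitly, since the group laws that would force \<open>f\<close> to preserve zero are
  only known for \<open>N\<close> afterwards.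
\<close>

locale rota_baxter_epi = rota_baxter_lie_algebra K M \<mu> B
  for K (structure) and M (structure) and \<mu> and B +
  fixes N (structure) and C and f
  assumes image: "f ` carrier M = carrier N"
    and f_zero: "f \<zero>\<^bsub>M\<^esub> = \<zero>\<^bsub>N\<^esub>"
    and f_add: "x \<in> carrier M \<Longrightarrow> y \<in> carrier M \<Longrightarrow> f (x \<oplus>\<^bsub>M\<^esub> y) = f x \<oplus>\<^bsub>N\<^esub> f y"
    and f_smult: "a \<in> carrier K \<Longrightarrow> x \<in> carrier M \<Longrightarrow> f (a \<odot>\<^bsub>M\<^esub> x) = a \<odot>\<^bsub>N\<^esub> f x"
    and f_bracket: "x \<in> carrier M \<Longrightarrow> y \<in> carrier M \<Longrightarrow> f \<lbrakk>x, y\<rbrakk>\<^bsub>M\<^esub> = \<lbrakk>f x, f y\<rbrakk>\<^bsub>N\<^esub>"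
    and f_operator: "x \<in> carrier M \<Longrightarrow> f (B x) = C (f x)"
begin

lemma B_closed: "x \<in> carrier M \<Longrightarrow> B x \<in> carrier M"
  using operator_linear by (auto simp: linear_hom_def)

lemma f_closed: "x \<in> carrier M \<Longrightarrow> f x \<in> carrier N"
  using image by blast

lemma preimage:
  assumes "u \<in> carrier N" obtains x where "x \<in> carrier M" "u = f x"
  using assms image by blast

text \<open>
  Every axiom is an equation or a closure condition in the operations, or asserts the existence of
  an additive inverse, so it passes from \<open>M\<close> to its image.
\<close>

lemma image_rota_baxter_lie_algebra: "rota_baxter_lie_algebra K N \<mu> C"
proof -
  have group: "abelian_group N"
  proof (rule abelian_groupI)
    fix u v w assume "u \<in> carrier N" "v \<in> carrier N" "w \<in> carrier N"
    then obtain x y z where x: "x \<in> carrier M" "y \<in> carrier M" "z \<in> carrier M"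
      and u: "u = f x" "v = f y" "w = f z" using preimage by metis
    show "(u \<oplus>\<^bsub>N\<^esub> v) \<oplus>\<^bsub>N\<^esub> w = u \<oplus>\<^bsub>N\<^esub> (v \<oplus>\<^bsub>N\<^esub> w)"
      unfolding u using x by (simp add: f_add[symmetric] M.a_assoc)
  next
    fix u v assume "u \<in> carrier N" "v \<in> carrier N"
    then obtain x y where x: "x \<in> carrier M" "y \<in> carrier M"
      and u: "u = f x" "v = f y" using preimage by metis
    show "u \<oplus>\<^bsub>N\<^esub> v \<in> carrier N"
      unfolding u using x by (simp add: f_add[symmetric] f_closed)
    show "u \<oplus>\<^bsub>N\<^esub> v = v \<oplus>\<^bsub>N\<^esub> u"
      unfolding u using x by (simp add: f_add[symmetric] M.a_comm)
  next
    fix u assume "u \<in> carrier N"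
    then obtain x where x: "x \<in> carrier M" and u: "u = f x" by (auto elim: preimage)
    show "\<zero>\<^bsub>N\<^esub> \<oplus>\<^bsub>N\<^esub> u = u"
      unfolding u using x by (simp add: f_add[symmetric] f_zero[symmetric])
    show "\<exists>v\<in>carrier N. v \<oplus>\<^bsub>N\<^esub> u = \<zero>\<^bsub>N\<^esub>"
    proof
      show "f (\<ominus>\<^bsub>M\<^esub> x) \<oplus>\<^bsub>N\<^esub> u = \<zero>\<^bsub>N\<^esub>"
        unfolding u using x by (simp add: f_add[symmetric] f_zero[symmetric] M.l_neg)
      show "f (\<ominus>\<^bsub>M\<^esub> x) \<in> carrier N"
        using x by (simp add: f_closed)
    qed
  qed (simp add: f_zero[symmetric] f_closed)
  have module: "module K N"
  proof (rule moduleI[OF is_cring group])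
    fix a u assume a: "a \<in> carrier K" and "u \<in> carrier N"
    then obtain x where x: "x \<in> carrier M" and u: "u = f x" by (auto elim: preimage)
    show "a \<odot>\<^bsub>N\<^esub> u \<in> carrier N"
      unfolding u using a x by (simp add: f_smult[symmetric] f_closed)
  next
    fix a b u assume a: "a \<in> carrier K" "b \<in> carrier K" and "u \<in> carrier N"
    then obtain x where x: "x \<in> carrier M" and u: "u = f x" by (auto elim: preimage)
    show "(a \<oplus>\<^bsub>K\<^esub> b) \<odot>\<^bsub>N\<^esub> u = a \<odot>\<^bsub>N\<^esub> u \<oplus>\<^bsub>N\<^esub> b \<odot>\<^bsub>N\<^esub> u"
      unfolding u using a x
      by (simp add: f_smult[symmetric] f_add[symmetric] smult_l_distr)
    show "(a \<otimes>\<^bsub>K\<^esub> b) \<odot>\<^bsub>N\<^esub> u = a \<odot>\<^bsub>N\<^esub> (b \<odot>\<^bsub>N\<^esub> u)"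
      unfolding u using a x by (simp add: f_smult[symmetric] smult_assoc1)
  next
    fix a u v assume a: "a \<in> carrier K" and "u \<in> carrier N" "v \<in> carrier N"
    then obtain x y where x: "x \<in> carrier M" "y \<in> carrier M" and u: "u = f x" "v = f y"
      using preimage by metis
    show "a \<odot>\<^bsub>N\<^esub> (u \<oplus>\<^bsub>N\<^esub> v) = a \<odot>\<^bsub>N\<^esub> u \<oplus>\<^bsub>N\<^esub> a \<odot>\<^bsub>N\<^esub> v"
      unfolding u using a x
      by (simp add: f_smult[symmetric] f_add[symmetric] smult_r_distr)
  next
    fix u assume "u \<in> carrier N"
    then obtain x where x: "x \<in> carrier M" and u: "u = f x" by (auto elim: preimage)
    show "\<one>\<^bsub>K\<^esub> \<odot>\<^bsub>N\<^esub> u = u"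
      unfolding u using x by (simp add: f_smult[symmetric])
  qed
  have lie: "lie_algebra K N"
  proof (intro lie_algebra.intro lie_algebra_axioms.intro module)
    show "field K" by (rule field_axioms)
  next
    fix u v assume "u \<in> carrier N" "v \<in> carrier N"
    then obtain x y where x: "x \<in> carrier M" "y \<in> carrier M" and u: "u = f x" "v = f y"
      using preimage by metis
    show "\<lbrakk>u, v\<rbrakk>\<^bsub>N\<^esub> \<in> carrier N"
      unfolding u using x by (simp add: f_bracket[symmetric] f_closed)
  next
    fix u assume "u \<in> carrier N"
    then obtain x where x: "x \<in> carrier M" and u: "u = f x" by (auto elim: preimage)
    show "\<lbrakk>u, u\<rbrakk>\<^bsub>N\<^esub> = \<zero>\<^bsub>N\<^esub>"
      unfolding u using x by (simp add: f_bracket[symmetric] f_zero[symmetric] bracket_alternating)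
  next
    fix a u v assume a: "a \<in> carrier K" and "u \<in> carrier N" "v \<in> carrier N"
    then obtain x y where x: "x \<in> carrier M" "y \<in> carrier M" and u: "u = f x" "v = f y"
      using preimage by metis
    show "\<lbrakk>a \<odot>\<^bsub>N\<^esub> u, v\<rbrakk>\<^bsub>N\<^esub> = a \<odot>\<^bsub>N\<^esub> \<lbrakk>u, v\<rbrakk>\<^bsub>N\<^esub>" "\<lbrakk>u, a \<odot>\<^bsub>N\<^esub> v\<rbrakk>\<^bsub>N\<^esub> = a \<odot>\<^bsub>N\<^esub> \<lbrakk>u, v\<rbrakk>\<^bsub>N\<^esub>"
      unfolding u using a x
      by (simp_all add: f_bracket[symmetric] f_smult[symmetric]
          bracket_smult_left bracket_smult_right)
  next
    fix u v w assume "u \<in> carrier N" "v \<in> carrier N" "w \<in> carrier N"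
    then obtain x y z where x: "x \<in> carrier M" "y \<in> carrier M" "z \<in> carrier M"
      and u: "u = f x" "v = f y" "w = f z" using preimage by metis
    show "\<lbrakk>u \<oplus>\<^bsub>N\<^esub> v, w\<rbrakk>\<^bsub>N\<^esub> = \<lbrakk>u, w\<rbrakk>\<^bsub>N\<^esub> \<oplus>\<^bsub>N\<^esub> \<lbrakk>v, w\<rbrakk>\<^bsub>N\<^esub>"
      "\<lbrakk>u, v \<oplus>\<^bsub>N\<^esub> w\<rbrakk>\<^bsub>N\<^esub> = \<lbrakk>u, v\<rbrakk>\<^bsub>N\<^esub> \<oplus>\<^bsub>N\<^esub> \<lbrakk>u, w\<rbrakk>\<^bsub>N\<^esub>"
      "\<lbrakk>u, \<lbrakk>v, w\<rbrakk>\<^bsub>N\<^esub>\<rbrakk>\<^bsub>N\<^esub> \<oplus>\<^bsub>N\<^esub> \<lbrakk>v, \<lbrakk>w, u\<rbrakk>\<^bsub>N\<^esub>\<rbrakk>\<^bsub>N\<^esub> \<oplus>\<^bsub>N\<^esub> \<lbrakk>w, \<lbrakk>u, v\<rbrakk>\<^bsub>N\<^esub>\<rbrakk>\<^bsub>N\<^esub> = \<zero>\<^bsub>N\<^esub>"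
      unfolding u using x
      by (simp_all add: f_bracket[symmetric] f_add[symmetric] f_zero[symmetric]
          bracket_add_left bracket_add_right jacobi)
  qed
  have C_linear: "C \<in> linear_hom K N N"
    unfolding linear_hom_def
  proof (intro CollectI conjI ballI funcsetI)
    fix u assume "u \<in> carrier N"
    then obtain x where x: "x \<in> carrier M" and u: "u = f x" by (auto elim: preimage)
    show "C u \<in> carrier N"
      unfolding u using x by (simp add: f_operator[symmetric] f_closed B_closed)
  next
    fix u v assume "u \<in> carrier N" "v \<in> carrier N"
    then obtain x y where x: "x \<in> carrier M" "y \<in> carrier M" and u: "u = f x" "v = f y"
      using preimage by metis
    have "B (x \<oplus>\<^bsub>M\<^esub> y) = B x \<oplus>\<^bsub>M\<^esub> B y"
      using operator_linear x by (auto simp: linear_hom_def)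
    then show "C (u \<oplus>\<^bsub>N\<^esub> v) = C u \<oplus>\<^bsub>N\<^esub> C v"
      unfolding u using x by (simp add: f_operator[symmetric] f_add[symmetric] B_closed)
  next
    fix a u assume a: "a \<in> carrier K" and "u \<in> carrier N"
    then obtain x where x: "x \<in> carrier M" and u: "u = f x" by (auto elim: preimage)
    have "B (a \<odot>\<^bsub>M\<^esub> x) = a \<odot>\<^bsub>M\<^esub> B x"
      using operator_linear a x by (auto simp: linear_hom_def)
    then show "C (a \<odot>\<^bsub>N\<^esub> u) = a \<odot>\<^bsub>N\<^esub> C u"
      unfolding u using a x by (simp add: f_operator[symmetric] f_smult[symmetric] B_closed)
  qed
  show ?thesis
  proof (intro rota_baxter_lie_algebra.intro rota_baxter_lie_algebra_axioms.intro
      lie weight_closed C_linear)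
    fix u v assume "u \<in> carrier N" "v \<in> carrier N"
    then obtain x y where x: "x \<in> carrier M" "y \<in> carrier M" and u: "u = f x" "v = f y"
      using preimage by metis
    show "\<lbrakk>C u, C v\<rbrakk>\<^bsub>N\<^esub> = C (\<lbrakk>C u, v\<rbrakk>\<^bsub>N\<^esub> \<oplus>\<^bsub>N\<^esub> \<lbrakk>u, C v\<rbrakk>\<^bsub>N\<^esub> \<oplus>\<^bsub>N\<^esub> \<mu> \<odot>\<^bsub>N\<^esub> \<lbrakk>u, v\<rbrakk>\<^bsub>N\<^esub>)"
      unfolding u using x
      by (simp add: f_operator[symmetric] f_bracket[symmetric] f_add[symmetric]
          f_smult[symmetric] B_closed weight_closed rota_baxter)
  qed
qed

sublocale image: rota_baxter_lie_algebra K N \<mu> C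
  by (rule image_rota_baxter_lie_algebra)

sublocale additive: abelian_group_hom M N f
  by (intro abelian_group_homI group_hom.intro group_hom_axioms.intro M.a_group image.M.a_group
      M.abelian_group_axioms image.M.abelian_group_axioms) (auto simp: hom_def f_closed f_add)

sublocale kernel: abelian_subgroup "a_kernel M N f" M
  by (rule additive.abelian_subgroup_a_kernel)

text \<open>
  Each operation on cosets is a union over representatives. Since \<open>f\<close> takes the same value at the
  results for all representatives, these results lie in one fibre, so by this lemma the union is a
  single coset.
\<close>

lemma coset_eq_fibre:
  assumes x: "x \<in> carrier M"
  shows "a_kernel M N f +>\<^bsub>M\<^esub> x = {z \<in> carrier M. f z = f x}"
proof (intro equalityI subsetI)
  fix z assume "z \<in> a_kernel M N f +>\<^bsub>M\<^esub> x"
  then obtain h where h: "h \<in> carrier M" "f h = \<zero>\<^bsub>N\<^esub>" and z: "z = h \<oplus>\<^bsub>M\<^esub> x"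
    unfolding a_r_coset_def' a_kernel_def' by blast
  have "f z = f x"
    unfolding z using x h f_closed[OF x] by (simp only: f_add image.M.l_zero)
  then show "z \<in> {z \<in> carrier M. f z = f x}"
    using x h z by simp
next
  fix z assume "z \<in> {z \<in> carrier M. f z = f x}"
  then have z: "z \<in> carrier M" "f z = f x" by auto
  have "z \<ominus>\<^bsub>M\<^esub> x \<in> a_kernel M N f"
    unfolding a_kernel_def' using x z f_closed[OF x]
    by (simp add: M.minus_eq image.M.r_neg)
  moreover have "z = (z \<ominus>\<^bsub>M\<^esub> x) \<oplus>\<^bsub>M\<^esub> x"
    using x z by (simp add: M.minus_eq M.a_assoc M.l_neg)
  ultimately show "z \<in> a_kernel M N f +>\<^bsub>M\<^esub> x"
    by (auto simp: a_r_coset_def')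
qed

lemma coset_projection_epi:
  defines "H \<equiv> a_kernel M N f"
  shows "rota_baxter_epi K M \<mu> B (quotient_lie M H) (quotient_map M H B) (\<lambda>x. H +>\<^bsub>M\<^esub> x)"
proof (intro rota_baxter_epi.intro rota_baxter_epi_axioms.intro)
  show "rota_baxter_lie_algebra K M \<mu> B"
    by (rule rota_baxter_lie_algebra_axioms)
  have fib: "H +>\<^bsub>M\<^esub> x = {z \<in> carrier M. f z = f x}" if "x \<in> carrier M" for x
    using coset_eq_fibre[OF that] by (simp add: H_def)
  show "(+>\<^bsub>M\<^esub>) H ` carrier M = carrier (quotient_lie M H)"
    by (auto simp: quotient_lie_def A_RCOSETS_def')
  show "H +>\<^bsub>M\<^esub> \<zero>\<^bsub>M\<^esub> = \<zero>\<^bsub>quotient_lie M H\<^esub>"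
    by (simp add: quotient_lie_def H_def kernel.a_subset)
  fix x assume x: "x \<in> carrier M"
  have self: "x \<in> H +>\<^bsub>M\<^esub> x" if "x \<in> carrier M" for x
    using that by (simp add: fib)
  have "H +>\<^bsub>M\<^esub> B z = H +>\<^bsub>M\<^esub> B x" if "z \<in> H +>\<^bsub>M\<^esub> x" for z
    using that x by (simp add: fib B_closed f_operator)
  from UN_constant_eq[OF self[OF x] ballI, OF this]
  show "H +>\<^bsub>M\<^esub> B x = quotient_map M H B (H +>\<^bsub>M\<^esub> x)"
    by (simp add: quotient_map_def)
  {
    fix a assume a: "a \<in> carrier K"
    have "H +>\<^bsub>M\<^esub> (a \<odot>\<^bsub>M\<^esub> z) = H +>\<^bsub>M\<^esub> (a \<odot>\<^bsub>M\<^esub> x)" if "z \<in> H +>\<^bsub>M\<^esub> x" for z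
      using that a x by (simp add: fib f_smult)
    from UN_constant_eq[OF self[OF x] ballI, OF this]
    show "H +>\<^bsub>M\<^esub> (a \<odot>\<^bsub>M\<^esub> x) = a \<odot>\<^bsub>quotient_lie M H\<^esub> (H +>\<^bsub>M\<^esub> x)"
      by (simp add: quotient_lie_def)
  }
  fix y assume y: "y \<in> carrier M"
  show "H +>\<^bsub>M\<^esub> (x \<oplus>\<^bsub>M\<^esub> y) = (H +>\<^bsub>M\<^esub> x) \<oplus>\<^bsub>quotient_lie M H\<^esub> (H +>\<^bsub>M\<^esub> y)"
    using kernel.a_rcos_sum[OF x y] by (simp add: quotient_lie_def H_def)
  have "H +>\<^bsub>M\<^esub> \<lbrakk>z, w\<rbrakk>\<^bsub>M\<^esub> = H +>\<^bsub>M\<^esub> \<lbrakk>x, y\<rbrakk>\<^bsub>M\<^esub>"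
    if "z \<in> H +>\<^bsub>M\<^esub> x" "w \<in> H +>\<^bsub>M\<^esub> y" for z w
    using that x y by (simp add: fib f_bracket)
  then have "(\<Union>w\<in>H +>\<^bsub>M\<^esub> y. H +>\<^bsub>M\<^esub> \<lbrakk>z, w\<rbrakk>\<^bsub>M\<^esub>) = H +>\<^bsub>M\<^esub> \<lbrakk>x, y\<rbrakk>\<^bsub>M\<^esub>" if "z \<in> H +>\<^bsub>M\<^esub> x" for z
    using that by (intro UN_constant_eq[OF self[OF y]] ballI)
  from UN_constant_eq[OF self[OF x] ballI, OF this]
  show "H +>\<^bsub>M\<^esub> \<lbrakk>x, y\<rbrakk>\<^bsub>M\<^esub> = \<lbrakk>H +>\<^bsub>M\<^esub> x, H +>\<^bsub>M\<^esub> y\<rbrakk>\<^bsub>quotient_lie M H\<^esub>"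
    by (simp add: quotient_lie_def)
qed

lemma first_isomorphism:
  defines "H \<equiv> a_kernel M N f"
  shows "rota_baxter_isomorphic K \<mu> N C (quotient_lie M H) (quotient_map M H B)"
proof -
  let ?Q = "quotient_lie M H" and ?b = "quotient_map M H B"
  interpret q: rota_baxter_epi K M \<mu> B ?Q ?b "\<lambda>x. H +>\<^bsub>M\<^esub> x"
    unfolding H_def by (rule coset_projection_epi)
  \<comment> \<open>The inverse of the induced map \<open>M/H \<rightarrow> N\<close> takes a point to its fibre.\<close>
  define g where "g = (\<lambda>u. {z \<in> carrier M. f z = u})"
  have gf: "g (f x) = H +>\<^bsub>M\<^esub> x" if "x \<in> carrier M" for x
    using coset_eq_fibre[OF that] by (simp add: g_def H_def)
  have hom: "g \<in> lie_hom K N ?Q"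
    unfolding lie_hom_def linear_hom_def
  proof (intro CollectI conjI ballI funcsetI)
    fix u assume "u \<in> carrier N"
    then obtain x where x: "x \<in> carrier M" and u: "u = f x" by (auto elim: preimage)
    show "g u \<in> carrier ?Q"
      unfolding u using x q.f_closed by (simp add: gf)
    fix a assume a: "a \<in> carrier K"
    show "g (a \<odot>\<^bsub>N\<^esub> u) = a \<odot>\<^bsub>?Q\<^esub> g u"
      unfolding u using a x by (simp add: gf q.f_smult flip: f_smult)
  next
    fix u v assume "u \<in> carrier N" "v \<in> carrier N"
    then obtain x y where x: "x \<in> carrier M" "y \<in> carrier M" and u: "u = f x" "v = f y"
      using preimage by metis
    show "g (u \<oplus>\<^bsub>N\<^esub> v) = g u \<oplus>\<^bsub>?Q\<^esub> g v"
      unfolding u using x by (simp add: gf q.f_add flip: f_add)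
    show "g \<lbrakk>u, v\<rbrakk>\<^bsub>N\<^esub> = \<lbrakk>g u, g v\<rbrakk>\<^bsub>?Q\<^esub>"
      unfolding u using x by (simp add: gf q.f_bracket flip: f_bracket)
  qed
  have commute: "g (C u) = ?b (g u)" if "u \<in> carrier N" for u
  proof -
    from that obtain x where x: "x \<in> carrier M" and u: "u = f x" by (rule preimage)
    show ?thesis
      unfolding u using x by (simp add: gf B_closed q.f_operator flip: f_operator)
  qed
  have "inj_on g (carrier N)"
  proof (rule inj_onI)
    fix u v assume "u \<in> carrier N" "v \<in> carrier N" and eq: "g u = g v"
    from \<open>u \<in> carrier N\<close> obtain x where "x \<in> carrier M" "u = f x" by (rule preimage)
    then have "x \<in> g u" by (simp add: g_def)
    moreover from this have "x \<in> g v" by (simp only: eq)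
    ultimately show "u = v" by (simp add: g_def)
  qed
  moreover have "g ` carrier N = carrier ?Q"
  proof -
    have "g ` carrier N = (\<lambda>x. g (f x)) ` carrier M"
      by (simp add: image image_image flip: image)
    also have "\<dots> = (\<lambda>x. H +>\<^bsub>M\<^esub> x) ` carrier M"
      by (simp add: gf)
    finally show ?thesis by (simp only: q.image)
  qed
  ultimately have "bij_betw g (carrier N) (carrier ?Q)"
    by (simp add: bij_betw_def)
  moreover have "rota_baxter_lie_hom K \<mu> N C ?Q ?b g"
    by (intro rota_baxter_lie_hom.intro rota_baxter_lie_hom_axioms.intro hom commute
        image_rota_baxter_lie_algebra q.image_rota_baxter_lie_algebra)
  ultimately show ?thesis
    unfolding rota_baxter_isomorphic_def by blast
qed

end

section \<open>Descendent Lie algebras\<close>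

context rota_baxter_minus_one
begin

lemma B_smult: "a \<in> carrier K \<Longrightarrow> x \<in> carrier L \<Longrightarrow> B (a \<odot>\<^bsub>L\<^esub> x) = a \<odot>\<^bsub>L\<^esub> B x"
  using operator_linear by (auto simp: linear_hom_def)

lemma tilde_smult:
  "a \<in> carrier K \<Longrightarrow> x \<in> carrier L \<Longrightarrow> tilde L B (a \<odot>\<^bsub>L\<^esub> x) = a \<odot>\<^bsub>L\<^esub> tilde L B x"
  by (simp add: tilde_def B_smult M.minus_eq smult_r_distr smult_r_minus)

lemma uminus_as_minus: "x \<in> carrier L \<Longrightarrow> \<ominus>\<^bsub>L\<^esub> x = \<zero>\<^bsub>L\<^esub> \<ominus>\<^bsub>L\<^esub> x"
  by (simp add: M.minus_eq)

lemma uminus_zero: "\<ominus>\<^bsub>L\<^esub> \<zero>\<^bsub>L\<^esub> = \<zero>\<^bsub>L\<^esub>"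
  by (simp add: a_inv_def)

lemma minus_self: "x \<in> carrier L \<Longrightarrow> x \<ominus>\<^bsub>L\<^esub> x = \<zero>\<^bsub>L\<^esub>"
  by (simp add: minus_eq_zero_iff)

lemma B_zero: "B \<zero>\<^bsub>L\<^esub> = \<zero>\<^bsub>L\<^esub>"
  using B_minus[of "\<zero>\<^bsub>L\<^esub>" "\<zero>\<^bsub>L\<^esub>"] by (simp add: minus_self)

lemma tilde_zero: "tilde L B \<zero>\<^bsub>L\<^esub> = \<zero>\<^bsub>L\<^esub>"
  by (simp add: tilde_def B_zero minus_self)

lemma B_uminus: "x \<in> carrier L \<Longrightarrow> B (\<ominus>\<^bsub>L\<^esub> x) = \<ominus>\<^bsub>L\<^esub> B x"
  using B_minus[of "\<zero>\<^bsub>L\<^esub>" x] by (simp add: uminus_as_minus[symmetric] B_zero)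

lemma tilde_uminus: "x \<in> carrier L \<Longrightarrow> tilde L B (\<ominus>\<^bsub>L\<^esub> x) = \<ominus>\<^bsub>L\<^esub> tilde L B x"
  using tilde_minus[of "\<zero>\<^bsub>L\<^esub>" x] by (simp add: uminus_as_minus[symmetric] tilde_zero)

lemma bracket_zero_left: "x \<in> carrier L \<Longrightarrow> \<lbrakk>\<zero>\<^bsub>L\<^esub>, x\<rbrakk>\<^bsub>L\<^esub> = \<zero>\<^bsub>L\<^esub>"
  using bracket_minus_left[of x x x] by (simp add: minus_self)

lemma bracket_uminus_right:
  "x \<in> carrier L \<Longrightarrow> y \<in> carrier L \<Longrightarrow> \<lbrakk>x, \<ominus>\<^bsub>L\<^esub> y\<rbrakk>\<^bsub>L\<^esub> = \<ominus>\<^bsub>L\<^esub> \<lbrakk>x, y\<rbrakk>\<^bsub>L\<^esub>"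
  using bracket_minus_right[of x "\<zero>\<^bsub>L\<^esub>" y] by (simp add: uminus_as_minus[symmetric] zero_right)

lemma bracket_uminus_left:
  "x \<in> carrier L \<Longrightarrow> y \<in> carrier L \<Longrightarrow> \<lbrakk>\<ominus>\<^bsub>L\<^esub> x, y\<rbrakk>\<^bsub>L\<^esub> = \<ominus>\<^bsub>L\<^esub> \<lbrakk>x, y\<rbrakk>\<^bsub>L\<^esub>"
  using bracket_minus_left[of "\<zero>\<^bsub>L\<^esub>" x y] by (simp add: uminus_as_minus[symmetric] bracket_zero_left)

lemma bracket_skew:
  assumes x: "x \<in> carrier L" and y: "y \<in> carrier L"
  shows "\<lbrakk>y, x\<rbrakk>\<^bsub>L\<^esub> = \<ominus>\<^bsub>L\<^esub> \<lbrakk>x, y\<rbrakk>\<^bsub>L\<^esub>"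
proof -
  have "\<lbrakk>x \<oplus>\<^bsub>L\<^esub> y, x \<oplus>\<^bsub>L\<^esub> y\<rbrakk>\<^bsub>L\<^esub>
      = (\<lbrakk>x, x\<rbrakk>\<^bsub>L\<^esub> \<oplus>\<^bsub>L\<^esub> \<lbrakk>y, x\<rbrakk>\<^bsub>L\<^esub>) \<oplus>\<^bsub>L\<^esub> (\<lbrakk>x, y\<rbrakk>\<^bsub>L\<^esub> \<oplus>\<^bsub>L\<^esub> \<lbrakk>y, y\<rbrakk>\<^bsub>L\<^esub>)"
    using x y by (simp add: bracket_add_left bracket_add_right)
  from trans[OF this[symmetric] bracket_alternating]
  have "\<lbrakk>y, x\<rbrakk>\<^bsub>L\<^esub> \<oplus>\<^bsub>L\<^esub> \<lbrakk>x, y\<rbrakk>\<^bsub>L\<^esub> = \<zero>\<^bsub>L\<^esub>"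
    using x y by (simp add: bracket_alternating)
  then show ?thesis
    using x y by (simp add: M.minus_equality)
qed

lemma B_add_tilde: "x \<in> carrier L \<Longrightarrow> B x \<oplus>\<^bsub>L\<^esub> tilde L B x = x"
  by (simp add: tilde_def M.minus_eq M.a_lcomm M.r_neg)

text \<open>The map \<open>x \<mapsto> (B x, tilde L B x)\<close> is injective, since \<open>x\<close> is the sum of the two components.\<close>

lemma eq_by_components:
  assumes "x \<in> carrier L" "y \<in> carrier L" "B x = B y" "tilde L B x = tilde L B y"
  shows "x = y"
  using assms B_add_tilde by metis

abbreviation dbracket :: "_ \<Rightarrow> _ \<Rightarrow> _"
  where "dbracket x y \<equiv> \<lbrakk>x, y\<rbrakk>\<^bsub>descendent L B\<^esub>"

lemma descendent_simps [simp]: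
  "carrier (descendent L B) = carrier L"
  "\<zero>\<^bsub>descendent L B\<^esub> = \<zero>\<^bsub>L\<^esub>"
  "x \<oplus>\<^bsub>descendent L B\<^esub> y = x \<oplus>\<^bsub>L\<^esub> y"
  "a \<odot>\<^bsub>descendent L B\<^esub> x = a \<odot>\<^bsub>L\<^esub> x"
  by (simp_all add: descendent_def)

lemma dbracket_def:
  "dbracket x y = \<lbrakk>B x, y\<rbrakk>\<^bsub>L\<^esub> \<oplus>\<^bsub>L\<^esub> \<lbrakk>x, B y\<rbrakk>\<^bsub>L\<^esub> \<ominus>\<^bsub>L\<^esub> \<lbrakk>x, y\<rbrakk>\<^bsub>L\<^esub>"
  by (simp add: descendent_def)

lemma dbracket_closed [simp]:
  "x \<in> carrier L \<Longrightarrow> y \<in> carrier L \<Longrightarrow> dbracket x y \<in> carrier L"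
  by (simp add: dbracket_def M.minus_closed)

lemma B_dbracket:
  "x \<in> carrier L \<Longrightarrow> y \<in> carrier L \<Longrightarrow> B (dbracket x y) = \<lbrakk>B x, B y\<rbrakk>\<^bsub>L\<^esub>"
  by (simp only: dbracket_def rota_baxter')

lemma tilde_dbracket:
  assumes x: "x \<in> carrier L" and y: "y \<in> carrier L"
  shows "tilde L B (dbracket x y) = \<ominus>\<^bsub>L\<^esub> \<lbrakk>tilde L B x, tilde L B y\<rbrakk>\<^bsub>L\<^esub>"
proof -
  have "tilde L B (dbracket x y) = dbracket x y \<ominus>\<^bsub>L\<^esub> \<lbrakk>B x, B y\<rbrakk>\<^bsub>L\<^esub>"
    using B_dbracket[OF x y] by (simp add: tilde_def)
  also have "\<dots> = \<ominus>\<^bsub>L\<^esub> \<lbrakk>tilde L B x, tilde L B y\<rbrakk>\<^bsub>L\<^esub>"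
    using x y
    by (simp add: dbracket_def tilde_def bracket_minus_left bracket_minus_right M.minus_closed)
      (simp add: M.minus_eq M.minus_add M.minus_minus M.a_ac)
  finally show ?thesis .
qed

text \<open>
  Passing from \<open>B\<close> to \<open>id - B\<close> turns \<open>[B x, y] + [x, B y]\<close> into \<open>2 [x, y]\<close> minus that sum;
  subtracting \<open>[x, y]\<close>, as weight \<open>-1\<close> prescribes, leaves the negative of the original bracket.
\<close>

lemma tilde_descendent_bracket:
  assumes x: "x \<in> carrier L" and y: "y \<in> carrier L"
  shows "\<lbrakk>x, y\<rbrakk>\<^bsub>descendent L (tilde L B)\<^esub> = \<ominus>\<^bsub>L\<^esub> dbracket x y"
  using x y
  by (simp add: descendent_def tilde_def bracket_minus_left bracket_minus_right M.minus_closed)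
    (simp add: M.minus_eq M.minus_add M.minus_minus M.a_ac M.r_neg1 M.r_neg2 M.r_neg M.l_neg)

lemma tilde_rota_baxter_minus_one: "rota_baxter_minus_one K L (tilde L B)"
proof (intro rota_baxter_minus_one.intro rota_baxter_lie_algebra.intro
    rota_baxter_lie_algebra_axioms.intro lie_algebra_axioms weight_closed)
  show "tilde L B \<in> linear_hom K L L"
    by (simp add: linear_hom_def tilde_add tilde_smult)
  fix x y assume x: "x \<in> carrier L" and y: "y \<in> carrier L"
  let ?T = "tilde L B"
  have "\<lbrakk>?T x, ?T y\<rbrakk>\<^bsub>L\<^esub> = ?T (\<ominus>\<^bsub>L\<^esub> dbracket x y)"
    using x y by (simp add: tilde_uminus tilde_dbracket M.minus_minus)
  also have "\<dots> = ?T (\<lbrakk>?T x, y\<rbrakk>\<^bsub>L\<^esub> \<oplus>\<^bsub>L\<^esub> \<lbrakk>x, ?T y\<rbrakk>\<^bsub>L\<^esub> \<ominus>\<^bsub>L\<^esub> \<lbrakk>x, y\<rbrakk>\<^bsub>L\<^esub>)"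
    using tilde_descendent_bracket[OF x y] by (simp add: descendent_def)
  finally show "\<lbrakk>?T x, ?T y\<rbrakk>\<^bsub>L\<^esub>
      = ?T (\<lbrakk>?T x, y\<rbrakk>\<^bsub>L\<^esub> \<oplus>\<^bsub>L\<^esub> \<lbrakk>x, ?T y\<rbrakk>\<^bsub>L\<^esub> \<oplus>\<^bsub>L\<^esub> (\<ominus>\<^bsub>K\<^esub> \<one>\<^bsub>K\<^esub>) \<odot>\<^bsub>L\<^esub> \<lbrakk>x, y\<rbrakk>\<^bsub>L\<^esub>)"
    using x y by (simp add: M.minus_eq smult_l_minus)
qed

text \<open>
  By \<open>B_dbracket\<close> and \<open>tilde_dbracket\<close>, the map \<open>x \<mapsto> (B x, - tilde L B x)\<close> embeds the descendent
  bracket into the bracket of \<open>L \<times> L\<close>. Hence the axioms on the bracket need only be checked after applying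
  \<open>B\<close> and \<open>tilde L B\<close>, where they reduce to those of \<open>L\<close>; in particular the Jacobi identity needs no
  expansion.
\<close>

lemma descendent_lie_algebra: "lie_algebra K (descendent L B)"
proof (intro lie_algebra.intro lie_algebra_axioms.intro)
  show "field K" by (rule field_axioms)
  have group: "abelian_group (descendent L B)"
    using M.abelian_group_axioms
    by (simp add: abelian_group_def abelian_monoid_def abelian_group_axioms_def descendent_def)
  show "module K (descendent L B)"
    by (rule moduleI[OF is_cring group])
      (simp_all add: smult_l_distr smult_r_distr smult_assoc1)
next
  fix x assume "x \<in> carrier (descendent L B)"
  then have c: "x \<in> carrier L" by simp
  show "dbracket x x = \<zero>\<^bsub>descendent L B\<^esub>"
    by (rule eq_by_components)
      (use c in \<open>simp_all add: B_dbracket tilde_dbracket bracket_alternating B_zero tilde_zero uminus_zero\<close>)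
next
  fix a x y
  assume "a \<in> carrier K" "x \<in> carrier (descendent L B)" "y \<in> carrier (descendent L B)"
  then have c: "a \<in> carrier K" "x \<in> carrier L" "y \<in> carrier L" by simp_all
  show "dbracket (a \<odot>\<^bsub>descendent L B\<^esub> x) y = a \<odot>\<^bsub>descendent L B\<^esub> dbracket x y"
    by (rule eq_by_components)
      (use c in \<open>simp_all add: B_dbracket tilde_dbracket B_smult tilde_smult
        bracket_smult_left smult_r_minus\<close>)
  show "dbracket x (a \<odot>\<^bsub>descendent L B\<^esub> y) = a \<odot>\<^bsub>descendent L B\<^esub> dbracket x y"
    by (rule eq_by_components)
      (use c in \<open>simp_all add: B_dbracket tilde_dbracket B_smult tilde_smult
        bracket_smult_right smult_r_minus\<close>)
next
  fix x y z
  assume "x \<in> carrier (descendent L B)" "y \<in> carrier (descendent L B)"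
    "z \<in> carrier (descendent L B)"
  then have c: "x \<in> carrier L" "y \<in> carrier L" "z \<in> carrier L" by simp_all
  show
    "dbracket (x \<oplus>\<^bsub>descendent L B\<^esub> y) z = dbracket x z \<oplus>\<^bsub>descendent L B\<^esub> dbracket y z"
    by (rule eq_by_components)
      (use c in \<open>simp_all add: B_dbracket tilde_dbracket B_add tilde_add bracket_add_left M.minus_add\<close>)
  show "dbracket x (y \<oplus>\<^bsub>descendent L B\<^esub> z) = dbracket x y \<oplus>\<^bsub>descendent L B\<^esub> dbracket x z"
    by (rule eq_by_components)
      (use c in \<open>simp_all add: B_dbracket tilde_dbracket B_add tilde_add bracket_add_right M.minus_add\<close>)
  show "dbracket x (dbracket y z) \<oplus>\<^bsub>descendent L B\<^esub> dbracket y (dbracket z x)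
      \<oplus>\<^bsub>descendent L B\<^esub> dbracket z (dbracket x y) = \<zero>\<^bsub>descendent L B\<^esub>"
    by (rule eq_by_components)
      (use c in \<open>simp_all add: B_dbracket tilde_dbracket B_add tilde_add bracket_uminus_right
        M.minus_minus B_zero tilde_zero jacobi\<close>)
qed simp

lemma descendent_rota_baxter:
  "rota_baxter_lie_algebra K (descendent L B) (\<ominus>\<^bsub>K\<^esub> \<one>\<^bsub>K\<^esub>) B"
proof (intro rota_baxter_lie_algebra.intro rota_baxter_lie_algebra_axioms.intro
    descendent_lie_algebra weight_closed)
  show "B \<in> linear_hom K (descendent L B) (descendent L B)"
    using operator_linear by (simp add: linear_hom_def)
  fix x y assume "x \<in> carrier (descendent L B)" "y \<in> carrier (descendent L B)"
  then have c: "x \<in> carrier L" "y \<in> carrier L" by simp_all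
  then show "dbracket (B x) (B y) = B (dbracket (B x) y \<oplus>\<^bsub>descendent L B\<^esub> dbracket x (B y)
      \<oplus>\<^bsub>descendent L B\<^esub> (\<ominus>\<^bsub>K\<^esub> \<one>\<^bsub>K\<^esub>) \<odot>\<^bsub>descendent L B\<^esub> dbracket x y)"
    by (simp add: B_add B_uminus B_dbracket smult_l_minus) (simp add: dbracket_def M.minus_eq)
qed


section \<open>The Lie algebra \<open>g_two\<close> as a quotient of both descendent Lie algebras\<close>

text \<open>Every value of \<open>C_tilde\<close> has this form: \<open>C_tilde (B x, tilde L B y)\<close> is \<open>antidiag (x - y)\<close>.\<close>

definition antidiag :: "'c \<Rightarrow> 'c \<times> 'c"
  where "antidiag x = (B (tilde L B x), \<ominus>\<^bsub>L\<^esub> B (tilde L B x))"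

lemma carrier_g_two: "carrier (g_two L B) = antidiag ` carrier L"
proof -
  have bc: "carrier (bicrossed L B) = B ` carrier L \<times> tilde L B ` carrier L"
    by (simp add: bicrossed_def bicrossed_product_def g_plus_def g_minus_def restrict_lie_def)
  have C: "C_tilde L B (B x, tilde L B y) = antidiag (x \<ominus>\<^bsub>L\<^esub> y)"
    if "x \<in> carrier L" "y \<in> carrier L" for x y
    using that by (simp add: C_tilde_eq antidiag_def B_tilde M.minus_closed)
  have "C_tilde L B ` carrier (bicrossed L B) = antidiag ` carrier L"
  proof (intro equalityI subsetI)
    fix p assume "p \<in> C_tilde L B ` carrier (bicrossed L B)"
    then obtain x y where "x \<in> carrier L" "y \<in> carrier L" "p = C_tilde L B (B x, tilde L B y)"
      unfolding bc by blast
    then show "p \<in> antidiag ` carrier L"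
      by (auto simp: C M.minus_closed)
  next
    fix p assume "p \<in> antidiag ` carrier L"
    then obtain x where x: "x \<in> carrier L" "p = antidiag x" by blast
    then have "p = C_tilde L B (B x, tilde L B \<zero>\<^bsub>L\<^esub>)"
      by (simp add: C M.minus_eq uminus_zero)
    then show "p \<in> C_tilde L B ` carrier (bicrossed L B)"
      unfolding bc using x by blast
  qed
  then show ?thesis
    by (simp add: g_two_def restrict_lie_def)
qed

lemma g_two_simps:
  "\<zero>\<^bsub>g_two L B\<^esub> = (\<zero>\<^bsub>L\<^esub>, \<zero>\<^bsub>L\<^esub>)"
  "(x, u) \<oplus>\<^bsub>g_two L B\<^esub> (y, v) = (x \<oplus>\<^bsub>L\<^esub> y, u \<oplus>\<^bsub>L\<^esub> v)"
  "a \<odot>\<^bsub>g_two L B\<^esub> (x, u) = (a \<odot>\<^bsub>L\<^esub> x, a \<odot>\<^bsub>L\<^esub> u)"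
  by (simp_all add: g_two_def bicrossed_def bicrossed_product_def g_plus_def g_minus_def
      restrict_lie_def)

text \<open>
  The inverse in the records \<open>g_plus\<close> and \<open>g_minus\<close> is taken relative to their smaller carriers;
  it agrees with the one of \<open>L\<close> because the carriers are subgroups.
\<close>

lemma minus_restrict_lie:
  assumes "subgroup S (add_monoid L)" "y \<in> S"
  shows "x \<ominus>\<^bsub>restrict_lie L S\<^esub> y = x \<ominus>\<^bsub>L\<^esub> y"
  using M.add.m_inv_consistent[OF assms]
  by (simp add: a_minus_def a_inv_def restrict_lie_def)

lemma additive_image_subgroup:
  assumes f: "f \<in> carrier L \<rightarrow> carrier L"
    and add: "\<And>x y. x \<in> carrier L \<Longrightarrow> y \<in> carrier L \<Longrightarrow> f (x \<oplus>\<^bsub>L\<^esub> y) = f x \<oplus>\<^bsub>L\<^esub> f y"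
  shows "subgroup (f ` carrier L) (add_monoid L)"
proof -
  have "group_hom (add_monoid L) (add_monoid L) f"
    using f add by (intro group_hom.intro group_hom_axioms.intro M.a_group) (auto simp: hom_def)
  from group_hom.img_is_subgroup[OF this] show ?thesis by simp
qed

text \<open>
  Both components reduce to one cancellation. Expanding \<open>[D x, D y]\<close> for \<open>D = B \<circ> tilde L B\<close> by the
  Rota-Baxter identity of \<open>B\<close> (first component) or of \<open>tilde L B\<close> (second component) yields two
  terms which the actions remove, and a third one which is the claimed value.
\<close>

lemma antidiag_bracket:
  assumes x: "x \<in> carrier L" and y: "y \<in> carrier L"
  shows "\<lbrakk>antidiag x, antidiag y\<rbrakk>\<^bsub>g_two L B\<^esub> = antidiag (dbracket x y)"
proof -
  interpret t: rota_baxter_minus_one K L "tilde L B" by (rule tilde_rota_baxter_minus_one)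
  let ?T = "tilde L B"
  let ?D = "\<lambda>z. B (?T z)"
  have cancel: "(p \<oplus>\<^bsub>L\<^esub> q \<ominus>\<^bsub>L\<^esub> r) \<oplus>\<^bsub>L\<^esub> \<ominus>\<^bsub>L\<^esub> p \<ominus>\<^bsub>L\<^esub> q = \<ominus>\<^bsub>L\<^esub> r"
    if "p \<in> carrier L" "q \<in> carrier L" "r \<in> carrier L" for p q r
  proof -
    have "(p \<oplus>\<^bsub>L\<^esub> q \<ominus>\<^bsub>L\<^esub> r) \<oplus>\<^bsub>L\<^esub> \<ominus>\<^bsub>L\<^esub> p \<ominus>\<^bsub>L\<^esub> q
        = (p \<oplus>\<^bsub>L\<^esub> \<ominus>\<^bsub>L\<^esub> p) \<oplus>\<^bsub>L\<^esub> ((q \<oplus>\<^bsub>L\<^esub> \<ominus>\<^bsub>L\<^esub> q) \<oplus>\<^bsub>L\<^esub> \<ominus>\<^bsub>L\<^esub> r)"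
      using that by (simp only: M.minus_eq M.a_ac M.a_closed M.a_inv_closed)
    then show ?thesis
      using that by (simp add: M.r_neg)
  qed
  have TB: "?T (B z) = ?D z" if "z \<in> carrier L" for z
    using that by (simp add: B_tilde)
  have l: "brhd_act L B (\<ominus>\<^bsub>L\<^esub> ?D u) (?D v) = \<ominus>\<^bsub>L\<^esub> B \<lbrakk>?D u, ?T v\<rbrakk>\<^bsub>L\<^esub>"
    if "u \<in> carrier L" "v \<in> carrier L" for u v
    \<comment> \<open>Here \<open>- D u\<close> is presented as \<open>tilde L B (- B u)\<close> and \<open>D v\<close> as \<open>B (tilde L B v)\<close>.\<close>
    using brhd_act_eq[of "\<ominus>\<^bsub>L\<^esub> B u" "?T v"] that
    by (simp add: tilde_uminus TB bracket_uminus_left B_uminus)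
  have r: "rhd_act L B (?D u) (\<ominus>\<^bsub>L\<^esub> ?D v) = \<ominus>\<^bsub>L\<^esub> ?T \<lbrakk>?D u, B v\<rbrakk>\<^bsub>L\<^esub>"
    if "u \<in> carrier L" "v \<in> carrier L" for u v
    using rhd_act_eq[of "?T u" "\<ominus>\<^bsub>L\<^esub> B v"] that
    by (simp add: tilde_uminus TB bracket_uminus_right)
  have fst: "\<lbrakk>?D x, ?D y\<rbrakk>\<^bsub>L\<^esub> \<oplus>\<^bsub>L\<^esub> brhd_act L B (\<ominus>\<^bsub>L\<^esub> ?D x) (?D y) \<ominus>\<^bsub>L\<^esub> brhd_act L B (\<ominus>\<^bsub>L\<^esub> ?D y) (?D x)
      = ?D (dbracket x y)"
  proof -
    have "\<lbrakk>?D x, ?D y\<rbrakk>\<^bsub>L\<^esub>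
        = B \<lbrakk>?D x, ?T y\<rbrakk>\<^bsub>L\<^esub> \<oplus>\<^bsub>L\<^esub> B \<lbrakk>?T x, ?D y\<rbrakk>\<^bsub>L\<^esub> \<ominus>\<^bsub>L\<^esub> B \<lbrakk>?T x, ?T y\<rbrakk>\<^bsub>L\<^esub>"
      using x y by (simp add: rota_baxter' B_add B_minus)
    moreover have "brhd_act L B (\<ominus>\<^bsub>L\<^esub> ?D y) (?D x) = B \<lbrakk>?T x, ?D y\<rbrakk>\<^bsub>L\<^esub>"
      using x y bracket_skew[of "?T x" "?D y"] by (simp add: l B_uminus M.minus_minus)
    moreover have "?D (dbracket x y) = \<ominus>\<^bsub>L\<^esub> B \<lbrakk>?T x, ?T y\<rbrakk>\<^bsub>L\<^esub>"
      using x y by (simp add: tilde_dbracket B_uminus)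
    ultimately show ?thesis
      using x y by (simp only: l cancel B_closed tilde_closed bracket_closed)
  qed
  have snd: "\<lbrakk>\<ominus>\<^bsub>L\<^esub> ?D x, \<ominus>\<^bsub>L\<^esub> ?D y\<rbrakk>\<^bsub>L\<^esub> \<oplus>\<^bsub>L\<^esub> rhd_act L B (?D x) (\<ominus>\<^bsub>L\<^esub> ?D y)
      \<ominus>\<^bsub>L\<^esub> rhd_act L B (?D y) (\<ominus>\<^bsub>L\<^esub> ?D x) = \<ominus>\<^bsub>L\<^esub> ?D (dbracket x y)"
  proof -
    have "\<lbrakk>\<ominus>\<^bsub>L\<^esub> ?D x, \<ominus>\<^bsub>L\<^esub> ?D y\<rbrakk>\<^bsub>L\<^esub> = \<lbrakk>?T (B x), ?T (B y)\<rbrakk>\<^bsub>L\<^esub>"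
      using x y by (simp add: bracket_uminus_left bracket_uminus_right M.minus_minus TB)
    also have "\<dots> = ?T \<lbrakk>?D x, B y\<rbrakk>\<^bsub>L\<^esub> \<oplus>\<^bsub>L\<^esub> ?T \<lbrakk>B x, ?D y\<rbrakk>\<^bsub>L\<^esub> \<ominus>\<^bsub>L\<^esub> ?T \<lbrakk>B x, B y\<rbrakk>\<^bsub>L\<^esub>"
      using x y t.rota_baxter'[of "B x" "B y"] by (simp add: tilde_add tilde_minus TB)
    finally have "\<lbrakk>\<ominus>\<^bsub>L\<^esub> ?D x, \<ominus>\<^bsub>L\<^esub> ?D y\<rbrakk>\<^bsub>L\<^esub> = \<dots>" .
    moreover have "rhd_act L B (?D y) (\<ominus>\<^bsub>L\<^esub> ?D x) = ?T \<lbrakk>B x, ?D y\<rbrakk>\<^bsub>L\<^esub>"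
      using x y bracket_skew[of "B x" "?D y"] by (simp add: r tilde_uminus M.minus_minus)
    moreover have "?D (dbracket x y) = ?T \<lbrakk>B x, B y\<rbrakk>\<^bsub>L\<^esub>"
      using x y by (simp add: B_dbracket B_tilde)
    ultimately show ?thesis
      using x y by (simp only: r cancel B_closed tilde_closed bracket_closed)
  qed
  have minus_plus: "p \<ominus>\<^bsub>g_plus L B\<^esub> brhd_act L B (\<ominus>\<^bsub>L\<^esub> ?D u) (?D v)
      = p \<ominus>\<^bsub>L\<^esub> brhd_act L B (\<ominus>\<^bsub>L\<^esub> ?D u) (?D v)" if "u \<in> carrier L" "v \<in> carrier L" for p u v
  proof -
    have "brhd_act L B (\<ominus>\<^bsub>L\<^esub> ?D u) (?D v) = B (\<ominus>\<^bsub>L\<^esub> \<lbrakk>?D u, ?T v\<rbrakk>\<^bsub>L\<^esub>)"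
      using that by (simp add: l B_uminus)
    then show ?thesis
      unfolding g_plus_def using that
      by (intro minus_restrict_lie additive_image_subgroup) (auto simp: B_add)
  qed
  have minus_minus: "p \<ominus>\<^bsub>g_minus L B\<^esub> rhd_act L B (?D u) (\<ominus>\<^bsub>L\<^esub> ?D v)
      = p \<ominus>\<^bsub>L\<^esub> rhd_act L B (?D u) (\<ominus>\<^bsub>L\<^esub> ?D v)" if "u \<in> carrier L" "v \<in> carrier L" for p u v
  proof -
    have "rhd_act L B (?D u) (\<ominus>\<^bsub>L\<^esub> ?D v) = ?T (\<ominus>\<^bsub>L\<^esub> \<lbrakk>?D u, B v\<rbrakk>\<^bsub>L\<^esub>)"
      using that by (simp add: r tilde_uminus)
    then show ?thesis
      unfolding g_minus_def using that
      by (intro minus_restrict_lie additive_image_subgroup) (auto simp: tilde_add)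
  qed
  have g_two_bracket: "\<lbrakk>(a, u), (b, v)\<rbrakk>\<^bsub>g_two L B\<^esub> =
      (\<lbrakk>a, b\<rbrakk>\<^bsub>L\<^esub> \<oplus>\<^bsub>L\<^esub> brhd_act L B u b \<ominus>\<^bsub>g_plus L B\<^esub> brhd_act L B v a,
       \<lbrakk>u, v\<rbrakk>\<^bsub>L\<^esub> \<oplus>\<^bsub>L\<^esub> rhd_act L B a v \<ominus>\<^bsub>g_minus L B\<^esub> rhd_act L B b u)" for a b u v
    by (simp add: g_two_def bicrossed_def bicrossed_product_def)
      (simp add: g_plus_def g_minus_def restrict_lie_def)
  show ?thesis
    unfolding antidiag_def g_two_bracket minus_plus[OF y x] minus_minus[OF y x] fst snd ..
qed

text \<open>
  In the decomposition \<open>x = B x + tilde L B x\<close>, both \<open>tilde L B\<close> of the first summand and \<open>B\<close> of the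
  second are equal to \<open>B (tilde L B x)\<close>. When this vanishes, the summands lie in \<open>h_plus\<close> and
  \<open>h_minus\<close>.
\<close>

lemma h_plus_add_h_minus:
  "h_plus L B <+>\<^bsub>L\<^esub> h_minus L B = {x \<in> carrier L. B (tilde L B x) = \<zero>\<^bsub>L\<^esub>}"
proof (intro equalityI subsetI)
  fix z assume "z \<in> h_plus L B <+>\<^bsub>L\<^esub> h_minus L B"
  then obtain x y where x: "x \<in> carrier L" "tilde L B x = \<zero>\<^bsub>L\<^esub>"
    and y: "y \<in> carrier L" "B y = \<zero>\<^bsub>L\<^esub>" and z: "z = x \<oplus>\<^bsub>L\<^esub> y"
    unfolding set_add_def' h_plus_def h_minus_def a_kernel_def' by blast
  have "B (tilde L B z) = B (tilde L B x) \<oplus>\<^bsub>L\<^esub> tilde L B (B y)"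
    using x(1) y(1) by (simp add: z tilde_add B_add B_tilde)
  then show "z \<in> {x \<in> carrier L. B (tilde L B x) = \<zero>\<^bsub>L\<^esub>}"
    using x y by (simp add: z B_zero tilde_zero)
next
  fix x assume "x \<in> {x \<in> carrier L. B (tilde L B x) = \<zero>\<^bsub>L\<^esub>}"
  then have x: "x \<in> carrier L" "B (tilde L B x) = \<zero>\<^bsub>L\<^esub>" by auto
  then have "B x \<in> h_plus L B" "tilde L B x \<in> h_minus L B"
    by (simp_all add: h_plus_def h_minus_def a_kernel_def' flip: B_tilde)
  then show "x \<in> h_plus L B <+>\<^bsub>L\<^esub> h_minus L B"
    using B_add_tilde[OF x(1)] unfolding set_add_def' by force
qed

lemma antidiag_eq_zero_iff:
  "x \<in> carrier L \<Longrightarrow> antidiag x = \<zero>\<^bsub>g_two L B\<^esub> \<longleftrightarrow> B (tilde L B x) = \<zero>\<^bsub>L\<^esub>"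
  by (auto simp: antidiag_def g_two_simps uminus_zero)

lemma antidiag_add:
  "x \<in> carrier L \<Longrightarrow> y \<in> carrier L \<Longrightarrow> antidiag (x \<oplus>\<^bsub>L\<^esub> y) = antidiag x \<oplus>\<^bsub>g_two L B\<^esub> antidiag y"
  by (simp add: antidiag_def g_two_simps B_add tilde_add M.minus_add)

lemma antidiag_smult:
  "a \<in> carrier K \<Longrightarrow> x \<in> carrier L \<Longrightarrow> antidiag (a \<odot>\<^bsub>L\<^esub> x) = a \<odot>\<^bsub>g_two L B\<^esub> antidiag x"
  by (simp add: antidiag_def g_two_simps B_smult tilde_smult smult_r_minus)

lemma C_tilde_fst:
  assumes x: "x \<in> carrier L"
  shows "C_tilde L B (B x, \<zero>\<^bsub>L\<^esub>) = antidiag x"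
  using C_tilde_eq[OF x M.zero_closed] x
  by (simp add: tilde_zero antidiag_def B_tilde M.minus_eq uminus_zero)

lemma C_tilde_snd:
  assumes x: "x \<in> carrier L"
  shows "C_tilde L B (\<zero>\<^bsub>L\<^esub>, tilde L B x) = antidiag (\<ominus>\<^bsub>L\<^esub> x)"
  using C_tilde_eq[OF M.zero_closed x] x
  by (simp add: B_zero antidiag_def B_tilde M.minus_eq)

lemma B_two_antidiag: "x \<in> carrier L \<Longrightarrow> B_two L B (antidiag x) = antidiag (B x)"
  using C_tilde_snd[of "\<ominus>\<^bsub>L\<^esub> B x"]
  by (simp add: B_two_def antidiag_def tilde_uminus B_tilde M.minus_minus)

lemma B_two_tilde_antidiag:
  "x \<in> carrier L \<Longrightarrow> B_two_tilde L B (antidiag x) = antidiag (tilde L B x)"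
  using C_tilde_fst[of "tilde L B x"] by (simp add: B_two_tilde_def antidiag_def)

lemma antidiag_epi:
  "rota_baxter_epi K (descendent L B) (\<ominus>\<^bsub>K\<^esub> \<one>\<^bsub>K\<^esub>) B (g_two L B) (B_two L B) antidiag"
  by (intro rota_baxter_epi.intro rota_baxter_epi_axioms.intro descendent_rota_baxter)
    (simp_all add: carrier_g_two antidiag_eq_zero_iff antidiag_add antidiag_smult
      antidiag_bracket B_two_antidiag B_zero tilde_zero)

text \<open>The sign compensates for the one in \<open>tilde_descendent_bracket\<close>.\<close>

lemma neg_antidiag_epi:
  "rota_baxter_epi K (descendent L (tilde L B)) (\<ominus>\<^bsub>K\<^esub> \<one>\<^bsub>K\<^esub>) (tilde L B)
    (g_two L B) (B_two_tilde L B) (\<lambda>x. antidiag (\<ominus>\<^bsub>L\<^esub> x))"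
proof -
  interpret t: rota_baxter_minus_one K L "tilde L B" by (rule tilde_rota_baxter_minus_one)
  show ?thesis
  proof (intro rota_baxter_epi.intro rota_baxter_epi_axioms.intro t.descendent_rota_baxter)
    have "(\<lambda>x. \<ominus>\<^bsub>L\<^esub> x) ` carrier L = carrier L"
    proof (intro equalityI subsetI)
      fix x assume "x \<in> carrier L"
      then show "x \<in> (\<lambda>x. \<ominus>\<^bsub>L\<^esub> x) ` carrier L"
        by (intro image_eqI[of _ _ "\<ominus>\<^bsub>L\<^esub> x"]) (simp_all add: M.minus_minus)
    qed auto
    then show "(\<lambda>x. antidiag (\<ominus>\<^bsub>L\<^esub> x)) ` carrier (descendent L (tilde L B)) = carrier (g_two L B)"
      unfolding carrier_g_two t.descendent_simps by (metis image_image)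
  next
    fix x y
    assume "x \<in> carrier (descendent L (tilde L B))" "y \<in> carrier (descendent L (tilde L B))"
    then have c: "x \<in> carrier L" "y \<in> carrier L" by simp_all
    have "dbracket (\<ominus>\<^bsub>L\<^esub> x) (\<ominus>\<^bsub>L\<^esub> y) = dbracket x y"
      using c by (simp add: dbracket_def B_uminus bracket_uminus_left bracket_uminus_right
          M.minus_minus)
    then show "antidiag (\<ominus>\<^bsub>L\<^esub> t.dbracket x y)
        = \<lbrakk>antidiag (\<ominus>\<^bsub>L\<^esub> x), antidiag (\<ominus>\<^bsub>L\<^esub> y)\<rbrakk>\<^bsub>g_two L B\<^esub>"
      using c by (simp add: tilde_descendent_bracket antidiag_bracket M.minus_minus)
  qed (simp_all add: antidiag_eq_zero_iff antidiag_add antidiag_smult M.minus_add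
      B_two_tilde_antidiag B_zero tilde_zero uminus_zero tilde_uminus flip: smult_r_minus)
qed

end

section \<open>The two isomorphisms\<close>

theorem theorem2p19:
  fixes K :: "('k, 'r) ring_scheme"
    and L :: "('k, 'a, 'm) lie_scheme"
    and B :: "'a \<Rightarrow> 'a"
  assumes "rota_baxter_lie_algebra K L (\<ominus>\<^bsub>K\<^esub> \<one>\<^bsub>K\<^esub>) B"
  shows "(rota_baxter_lie_algebra K (g_two L B) (\<ominus>\<^bsub>K\<^esub> \<one>\<^bsub>K\<^esub>) (B_two L B) \<and>
      rota_baxter_isomorphic K (\<ominus>\<^bsub>K\<^esub> \<one>\<^bsub>K\<^esub>)
        (g_two L B) (B_two L B)
        (quotient_lie (descendent L B) (h_plus L B <+>\<^bsub>L\<^esub> h_minus L B))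
        (quotient_map (descendent L B) (h_plus L B <+>\<^bsub>L\<^esub> h_minus L B) B))
    \<and> (rota_baxter_lie_algebra K (g_two L B) (\<ominus>\<^bsub>K\<^esub> \<one>\<^bsub>K\<^esub>) (B_two_tilde L B) \<and>
      rota_baxter_isomorphic K (\<ominus>\<^bsub>K\<^esub> \<one>\<^bsub>K\<^esub>)
        (g_two L B) (B_two_tilde L B)
        (quotient_lie (descendent L (tilde L B)) (h_plus L B <+>\<^bsub>L\<^esub> h_minus L B))
        (quotient_map (descendent L (tilde L B)) (h_plus L B <+>\<^bsub>L\<^esub> h_minus L B) (tilde L B)))"
proof -
  interpret rota_baxter_minus_one K L B
    using assms by (rule rota_baxter_minus_one.intro)
  interpret p: rota_baxter_epi K "descendent L B" "\<ominus>\<^bsub>K\<^esub> \<one>\<^bsub>K\<^esub>" B "g_two L B" "B_two L B" antidiag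
    by (rule antidiag_epi)
  interpret n: rota_baxter_epi K "descendent L (tilde L B)" "\<ominus>\<^bsub>K\<^esub> \<one>\<^bsub>K\<^esub>" "tilde L B"
    "g_two L B" "B_two_tilde L B" "\<lambda>x. antidiag (\<ominus>\<^bsub>L\<^esub> x)"
    by (rule neg_antidiag_epi)
  let ?H = "h_plus L B <+>\<^bsub>L\<^esub> h_minus L B"
  have "a_kernel (descendent L B) (g_two L B) antidiag = ?H"
    by (auto simp: h_plus_add_h_minus a_kernel_def' antidiag_eq_zero_iff)
  moreover have "a_kernel (descendent L (tilde L B)) (g_two L B) (\<lambda>x. antidiag (\<ominus>\<^bsub>L\<^esub> x)) = ?H"
  proof -
    have "carrier (descendent L (tilde L B)) = carrier L"
      by (simp add: descendent_def)
    moreover have "\<ominus>\<^bsub>L\<^esub> u = \<zero>\<^bsub>L\<^esub> \<longleftrightarrow> u = \<zero>\<^bsub>L\<^esub>" if "u \<in> carrier L" for u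
      using that by (metis M.minus_minus uminus_zero)
    ultimately show ?thesis
      by (auto simp: h_plus_add_h_minus a_kernel_def' antidiag_eq_zero_iff tilde_uminus B_uminus)
  qed
  ultimately show ?thesis
    using p.image_rota_baxter_lie_algebra p.first_isomorphism
      n.image_rota_baxter_lie_algebra n.first_isomorphism by simp
qed

end
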